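(* Let $d\ge 1$. For a probability distribution $P_{\mathbf{X}}$ of a random vector $\mathbf{X}$ in $\mathbb{R}^d$ with mean $\boldsymbol{\mu}=\mathbb{E}[\mathbf{X}]$ and (finite, invertible) covariance matrix $\boldsymbol{\Sigma}=\mathrm{Cov}[\mathbf{X}]$, define the maps $$T_{\mathrm{VCReg}}(\mathbf{x})=\boldsymbol{\Sigma}^{-1/2}(\mathbf{x}-\boldsymbol{\mu}),$$ $$T_{\mathrm{Radial\text{-}VCReg}}(\mathbf{x})=\frac{\boldsymbol{\Sigma}^{-1/2}(\mathbf{x}-\boldsymbol{\mu})}{\|\boldsymbol{\Sigma}^{-1/2}(\mathbf{x}-\boldsymbol{\mu})\|_2}\;F_{\chi}^{-1}\Big(F_{R}\big(\|\boldsymbol{\Sigma}^{-1/2}(\mathbf{x}-\boldsymbol{\mu})\|_2\big)\Big),$$ where $F_R$ is the cumulative distribution function of the random variable $R=\|\boldsymbol{\Sigma}^{-1/2}(\mathbf{X}-\boldsymbol{\mu})\|_2$ and $F_\chi^{-1}$ is the inverse cumulative distribution function of the $\chi(d)$ distribution. Let $$\mathcal{F}_{\mathrm{VCReg}}=\{P_{\mathbf{X}} : T_{\mathrm{VCReg}\#}P_{\mathbf{X}}=\mathcal{N}(\mathbf{0},\mathbf{I}_d)\},\qquad \mathcal{F}_{\mathrm{Radial\text{-}VCReg}}=\{P_{\mathbf{X}} : T_{\mathrm{Radial\text{-}VCReg}\#}P_{\mathbf{X}}=\mathcal{N}(\mathbf{0},\mathbf{I}_d)\}.$$ Then $\mathcal{F}_{\mathrm{VCReg}}\subsetneq\mathcal{F}_{\mathrm{Radial\text{-}VCReg}}$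 (strict inclusion).
   Context: The maps $T_{\mathrm{VCReg}}$ and $T_{\mathrm{Radial\text{-}VCReg}}$ depend on $P_{\mathbf{X}}$ through $\boldsymbol{\mu}$, $\boldsymbol{\Sigma}$ and $F_R$. The distributions $P_{\mathbf{X}}$ considered are Borel probability measures on $\mathbb{R}^d$ with finite second moments and invertible (positive definite) covariance matrix; $\boldsymbol{\Sigma}^{-1/2}$ is the inverse of the symmetric positive definite square root of $\boldsymbol{\Sigma}$. $T_{\#}P$ denotes the pushforward measure of $P$ under $T$. Membership in $\mathcal{F}_{\mathrm{Radial\text{-}VCReg}}$ requires that $T_{\mathrm{Radial\text{-}VCReg}}(\mathbf{x})$ be well defined (nonzero denominator, finite value) for $P_{\mathbf{X}}$-almost every $\mathbf{x}$. $\chi(d)$ is the Chi distribution with $d$ degrees of freedom, with density $r^{d-1}e^{-r^2/2}/(2^{d/2-1}\Gamma(d/2))$ on $r>0$, i.e. the law of the Euclidean norm of a standard Gaussian vector in $\mathbb{R}^d$. $\mathcal{N}(\mathbf{0},\mathbf{I}_d)$ is the standard Gaussian distribution on $\mathbb{R}^d$. *)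

theory Defs
  imports "HOL-Probability.Probability"
begin

definition std_gaussian :: "(real ^ 'n) measure" where
  "std_gaussian =
     density lborel (\<lambda>x. ennreal (exp (- (norm x)\<^sup>2 / 2) / sqrt (2 * pi) ^ CARD('n)))"

definition chi_distribution :: "nat \<Rightarrow> real measure" where
  "chi_distribution d =
     density lborel (\<lambda>r. ennreal
       (if 0 < r
        then r ^ (d - 1) * exp (- r\<^sup>2 / 2) / (2 powr (real d / 2 - 1) * Gamma (real d / 2))
        else 0))"

text \<open>The inverse cumulative distribution function. It takes extended real values so that a missing
  finite value is visible: for a distribution with unbounded support it is \<open>\<infinity>\<close> at \<open>p = 1\<close>,
  and it is always \<open>-\<infinity>\<close> at \<open>p = 0\<close>. For the chi distribution it is the ordinary inverse
  of the strictly increasing function \<open>cdf\<close> on \<open>0 < p < 1\<close>.\<close>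

definition quantile :: "real measure \<Rightarrow> real \<Rightarrow> ereal" where
  "quantile M p = Inf (ereal ` {r. p \<le> cdf M r})"

definition mean_vector :: "(real ^ 'n) measure \<Rightarrow> real ^ 'n" where
  "mean_vector P = (\<integral>x. x \<partial>P)"

definition covariance_matrix :: "(real ^ 'n) measure \<Rightarrow> real ^ 'n ^ 'n" where
  "covariance_matrix P =
     (\<chi> i j. \<integral>x. (x $ i - mean_vector P $ i) * (x $ j - mean_vector P $ j) \<partial>P)"

definition sym_pos_def :: "real ^ 'n ^ 'n \<Rightarrow> bool" where
  "sym_pos_def A \<longleftrightarrow> transpose A = A \<and> (\<forall>x. x \<noteq> 0 \<longrightarrow> 0 < x \<bullet> (A *v x))"

definition matrix_sqrt :: "real ^ 'n ^ 'n \<Rightarrow> real ^ 'n ^ 'n" where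
  "matrix_sqrt A = (THE S. sym_pos_def S \<and> S ** S = A)"

text \<open>A covariance matrix is always symmetric positive semidefinite, so invertibility amounts to
  positive definiteness and \<open>matrix_sqrt\<close> is well defined on it.\<close>

definition admissible :: "(real ^ 'n) measure \<Rightarrow> bool" where
  "admissible P \<longleftrightarrow>
     prob_space P \<and> sets P = sets borel \<and>
     integrable P (\<lambda>x. (norm x)\<^sup>2) \<and>
     invertible (covariance_matrix P)"

definition T_VCReg :: "(real ^ 'n) measure \<Rightarrow> real ^ 'n \<Rightarrow> real ^ 'n" where
  "T_VCReg P x = matrix_inv (matrix_sqrt (covariance_matrix P)) *v (x - mean_vector P)"

definition F_R :: "(real ^ 'n) measure \<Rightarrow> real \<Rightarrow> real" where
  "F_R P = cdf (distr P borel (\<lambda>x. norm (T_VCReg P x)))"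

definition radial_value :: "(real ^ 'n) measure \<Rightarrow> real ^ 'n \<Rightarrow> ereal" where
  "radial_value P x = quantile (chi_distribution CARD('n)) (F_R P (norm (T_VCReg P x)))"

definition T_Radial_VCReg :: "(real ^ 'n) measure \<Rightarrow> real ^ 'n \<Rightarrow> real ^ 'n" where
  "T_Radial_VCReg P x =
     real_of_ereal (radial_value P x) *\<^sub>R ((1 / norm (T_VCReg P x)) *\<^sub>R T_VCReg P x)"

text \<open>The total function \<open>T_Radial_VCReg\<close> takes the junk value \<open>0\<close> where the denominator is zero or
  the inverse cumulative distribution function is infinite; the following predicate singles out the
  points where it has its intended meaning.\<close>

definition radial_well_defined_at :: "(real ^ 'n) measure \<Rightarrow> real ^ 'n \<Rightarrow> bool" where
  "radial_well_defined_at P x \<longleftrightarrow> norm (T_VCReg P x) \<noteq> 0 \<and> \<bar>radial_value P x\<bar> \<noteq> \<infinity>"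

definition Fam_VCReg :: "(real ^ 'n) measure set" where
  "Fam_VCReg = {P. admissible P \<and> distr P borel (T_VCReg P) = std_gaussian}"

definition Fam_Radial_VCReg :: "(real ^ 'n) measure set" where
  "Fam_Radial_VCReg =
     {P. admissible P \<and> (AE x in P. radial_well_defined_at P x) \<and>
         distr P borel (T_Radial_VCReg P) = std_gaussian}"

end

theory Submission
  imports Defs
begin

text \<open>The norm of a standard Gaussian vector is chi distributed. If \<open>T_VCReg\<close> maps \<open>P\<close> to the standard
  Gaussian, then \<open>F_R\<close> is therefore the chi distribution function, the radial correction is the
  identity and \<open>T_Radial_VCReg P = T_VCReg P\<close>.

  For strictness, take the law of \<open>x / (1 + norm x)\<close> with \<open>x\<close> standard Gaussian. It is invariant
  under signed permutations of the coordinates, so it has mean zero and covariance \<open>c\<close> times the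
  identity, and \<open>T_VCReg\<close> is a scaling. Its law is bounded, hence stays non-Gaussian under this
  scaling. But \<open>x \<mapsto> x / (1 + norm x)\<close> is strictly increasing along rays, so \<open>F_R\<close> at the image of
  \<open>x\<close> is the chi distribution function at \<open>norm x\<close>, and \<open>T_Radial_VCReg\<close> recovers \<open>x\<close> itself.\<close>

section \<open>Signed coordinate permutations\<close>

text \<open>For bijective \<open>p\<close> and signs \<open>s k\<close> these are the symmetries of
  the cube. They carry boxes to boxes, so invariance of Lebesgue measure is easy to check, and there
  are enough of them to force an invariant covariance matrix to be scalar.\<close>

definition signed_perm :: "('n \<Rightarrow> real) \<Rightarrow> ('n \<Rightarrow> 'n) \<Rightarrow> real ^ 'n \<Rightarrow> real ^ 'n" where
  "signed_perm s p x = (\<chi> k. s k * x $ p k)"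

lemma measurable_signed_perm [measurable]: "signed_perm s p \<in> borel_measurable borel"
  unfolding signed_perm_def by (intro borel_measurable_continuous_onI continuous_intros)

lemma norm_signed_perm:
  assumes p: "bij p" and s: "\<And>k. \<bar>s k\<bar> = 1"
  shows "norm (signed_perm s p x) = norm x"
proof -
  have "(\<Sum>k\<in>UNIV. (s k * x $ p k)\<^sup>2) = (\<Sum>k\<in>UNIV. (x $ p k)\<^sup>2)"
    using s by (intro sum.cong refl) (metis power2_abs abs_mult mult_1)
  also have "\<dots> = (\<Sum>k\<in>UNIV. (x $ k)\<^sup>2)"
    by (rule sum.reindex_bij_betw[OF p])
  finally show ?thesis
    by (simp add: norm_vec_def L2_set_def signed_perm_def)
qed

lemma prod_Basis_cart:
  fixes f :: "real ^ 'n"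
  shows "(\<Prod>b\<in>Basis. f \<bullet> b) = (\<Prod>k\<in>UNIV. f $ k)"
proof -
  have B: "(Basis :: (real ^ 'n) set) = range (\<lambda>k. axis k 1)"
    by (auto simp: Basis_vec_def)
  show ?thesis
    unfolding B by (subst prod.reindex) (auto simp: inj_on_def axis_eq_axis inner_axis)
qed

text \<open>Lebesgue measure is determined by its values on boxes, and the preimage of a box is a
  box with the same side lengths in another order.\<close>

lemma lborel_distr_signed_perm:
  fixes p :: "'n::finite \<Rightarrow> 'n"
  assumes p: "bij p" and s: "\<And>k. \<bar>s k\<bar> = 1"
  shows "distr lborel borel (signed_perm s p) = lborel"
proof (rule lborel_eqI [symmetric])
  fix l u :: "real ^ 'n"
  assume le: "\<And>b. b \<in> Basis \<Longrightarrow> l \<bullet> b \<le> u \<bullet> b"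
  have le': "l $ k \<le> u $ k" for k
    using le[of "axis k 1"] by (simp add: inner_axis axis_in_Basis_iff)
  define q where "q = inv p"
  have q: "bij q" unfolding q_def by (rule bij_imp_bij_inv[OF p])
  have pq: "p (q k) = k" "q (p k) = k" for k
    using p by (simp_all add: q_def bij_is_surj surj_f_inv_f bij_is_inj)
  \<comment> \<open>Input coordinate \<open>j\<close> ends up in output coordinate
    \<open>q j\<close>. A sign -1 there reflects the interval, so its endpoints are negated and
    swapped.\<close>
  define l' u' :: "real ^ 'n" where
    "l' = (\<chi> j. if s (q j) = 1 then l $ q j else - u $ q j)" and
    "u' = (\<chi> j. if s (q j) = 1 then u $ q j else - l $ q j)"
  have s': "s k = 1 \<or> s k = -1" for k using s[of k] by (auto simp: abs_if split: if_splits)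
  have "x \<in> signed_perm s p -` box l u \<longleftrightarrow> x \<in> box l' u'" for x
  proof -
    have "(l $ k < s k * x $ p k \<and> s k * x $ p k < u $ k) \<longleftrightarrow>
        (l' $ p k < x $ p k \<and> x $ p k < u' $ p k)" for k
      using s'[of k] by (auto simp: l'_def u'_def pq)
    then have "x \<in> signed_perm s p -` box l u \<longleftrightarrow> (\<forall>k. l' $ p k < x $ p k \<and> x $ p k < u' $ p k)"
      by (simp add: mem_box_cart signed_perm_def)
    also have "\<dots> \<longleftrightarrow> x \<in> box l' u'"
      unfolding mem_box_cart using pq by metis
    finally show ?thesis .
  qed
  then have vim: "signed_perm s p -` box l u = box l' u'" by blast
  have diff: "u' $ j - l' $ j = u $ q j - l $ q j" for j
    by (simp add: l'_def u'_def)
  have box_le: "l' $ j \<le> u' $ j" for j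
    using diff[of j] le'[of "q j"] by linarith
  have "emeasure (distr lborel borel (signed_perm s p)) (box l u) = emeasure lborel (box l' u')"
    by (subst emeasure_distr) (auto simp: vim)
  also have "\<dots> = ennreal (\<Prod>b\<in>Basis. (u' - l') \<bullet> b)"
    using box_le by (subst emeasure_lborel_box) (auto simp: Basis_vec_def inner_axis)
  also have "(\<Prod>b\<in>Basis. (u' - l') \<bullet> b) = (\<Prod>j\<in>UNIV. (u' - l') $ j)"
    by (simp add: prod_Basis_cart)
  also have "\<dots> = (\<Prod>j\<in>UNIV. (u - l) $ q j)"
    by (simp add: diff)
  also have "\<dots> = (\<Prod>j\<in>UNIV. (u - l) $ j)"
    by (rule prod.reindex_bij_betw[OF q])
  also have "\<dots> = (\<Prod>b\<in>Basis. (u - l) \<bullet> b)"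
    by (simp add: prod_Basis_cart)
  finally show "emeasure (distr lborel borel (signed_perm s p)) (box l u) =
      ennreal (\<Prod>b\<in>Basis. (u - l) \<bullet> b)" .
qed simp

section \<open>The standard Gaussian and the chi distribution\<close>

lemma sets_std_gaussian [simp, measurable_cong]: "sets std_gaussian = sets borel"
  by (simp add: std_gaussian_def)

lemma space_std_gaussian [simp]: "space std_gaussian = UNIV"
  by (simp add: std_gaussian_def)

text \<open>Polar coordinates for radial functions: the density is the derivative of the ball volume
  in the radius. Comparing both measures on the half-lines \<open>{..r}\<close> is enough, since
  these are stable under intersection, generate the Borel sets, and have finite measure.\<close>

lemma distr_lborel_norm:
  "distr (lborel :: 'a::euclidean_space measure) borel norm =
     density lborel (\<lambda>r. ennreal
       (if 0 < r then DIM('a) * unit_ball_vol DIM('a) * r ^ (DIM('a) - 1) else 0))"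
  (is "?M = density lborel (\<lambda>r. ennreal (?g r))")
proof (rule measure_eqI_generator_eq [where E = "range atMost" and A = "\<lambda>i. {..real i}" and \<Omega> = UNIV])
  have val: "emeasure ?M {..r} = (if 0 \<le> r then ennreal (unit_ball_vol DIM('a) * r ^ DIM('a)) else 0)" for r
  proof -
    have "emeasure ?M {..r} = emeasure lborel (cball (0::'a) r)"
      by (subst emeasure_distr) (auto intro!: arg_cong[where f = "emeasure lborel"])
    then show ?thesis by (auto simp: emeasure_cball)
  qed
  show "emeasure ?M X = emeasure (density lborel (\<lambda>r. ennreal (?g r))) X" if X: "X \<in> range atMost" for X
  proof -
    obtain r where X: "X = {..r}" using X by auto
    show ?thesis
    proof (cases "0 \<le> r")
      case True
      let ?h = "\<lambda>x. DIM('a) * unit_ball_vol DIM('a) * x ^ (DIM('a) - 1)"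
      have "emeasure (density lborel (\<lambda>r. ennreal (?g r))) X = (\<integral>\<^sup>+x. ennreal (?g x) * indicator {..r} x \<partial>lborel)"
        by (subst emeasure_density) (auto simp: X)
      \<comment> \<open>In dimension one the two integrands differ at 0, because
        \<open>0 ^ 0 = 1\<close>; this point is a null set.\<close>
      also have "\<dots> = (\<integral>\<^sup>+x. ennreal (?h x) * indicator {0..r} x \<partial>lborel)"
        by (intro nn_integral_cong_AE AE_I[of _ _ "{0}"]) (auto simp: indicator_def)
      also have "\<dots> = ennreal (unit_ball_vol DIM('a) * r ^ DIM('a) - unit_ball_vol DIM('a) * 0 ^ DIM('a))"
        using True by (intro nn_integral_FTC_Icc) (auto intro!: derivative_eq_intros)
      finally show ?thesis using True by (simp add: X val)
    next
      case False
      have "emeasure (density lborel (\<lambda>r. ennreal (?g r))) X = (\<integral>\<^sup>+x. ennreal (?g x) * indicator {..r} x \<partial>lborel)"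
        by (subst emeasure_density) (auto simp: X)
      also have "\<dots> = (\<integral>\<^sup>+(x::real). 0 \<partial>lborel)"
        using False by (intro nn_integral_cong) (auto simp: indicator_def)
      finally have "emeasure (density lborel (\<lambda>r. ennreal (?g r))) X = 0" by simp
      then show ?thesis using False by (simp add: X val)
    qed
  qed
  show "emeasure ?M {..real i} \<noteq> \<infinity>" for i by (simp add: val)
  show "sets ?M = sigma_sets UNIV (range atMost)"
    "sets (density lborel (\<lambda>r. ennreal (?g r))) = sigma_sets UNIV (range atMost)"
    by (simp_all add: borel_eq_atMost)
  show "(\<Union>i. {..real i}) = UNIV" by (auto simp: real_arch_simple)
qed (auto simp: Int_stable_def)

text \<open>The Gaussian density is a function of the norm, so it passes through the pushforward and
  multiplies the radial density of Lebesgue measure. What remains is to match the constants.\<close>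

lemma distr_std_gaussian_norm:
  "distr (std_gaussian :: (real ^ 'n) measure) borel norm = chi_distribution CARD('n)"
proof -
  let ?d = "CARD('n)"
  let ?g = "\<lambda>r::real. ennreal (exp (- r\<^sup>2 / 2) / sqrt (2 * pi) ^ ?d)"
  let ?v = "\<lambda>r::real. ennreal (if 0 < r then ?d * unit_ball_vol ?d * r ^ (?d - 1) else 0)"
  have "distr (std_gaussian :: (real ^ 'n) measure) borel norm =
      density (distr (lborel :: (real ^ 'n) measure) borel norm) ?g"
    unfolding std_gaussian_def by (subst density_distr) auto
  also have "\<dots> = density lborel (\<lambda>r. ?v r * ?g r)"
    by (subst distr_lborel_norm, subst density_density_eq) (simp_all cong: if_cong)
  also have "\<dots> = chi_distribution ?d"
    unfolding chi_distribution_def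
  proof (intro density_cong AE_I2)
    have pos: "0 < Gamma (real ?d / 2)" by (intro Gamma_real_pos) simp
    have G: "Gamma (real ?d / 2 + 1) = real ?d / 2 * Gamma (real ?d / 2)"
    proof (rule Gamma_plus1)
      show "real ?d / 2 \<notin> \<int>\<^sub>\<le>\<^sub>0" using nonpos_Ints_nonpos[of "real ?d / 2"] by auto
    qed
    have S: "sqrt (2 * pi) ^ ?d = 2 powr (?d / 2) * pi powr (?d / 2)"
      by (simp add: powr_half_sqrt[symmetric] powr_realpow[symmetric] powr_powr powr_mult)
    \<comment> \<open>The powers of \<open>pi\<close> cancel, and the functional equation of
      \<open>Gamma\<close> turns the factor \<open>?d\<close> into 2, which lowers the exponent of 2
      by one.\<close>
    have c: "?d * unit_ball_vol ?d / sqrt (2 * pi) ^ ?d =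
        1 / (2 powr (real ?d / 2 - 1) * Gamma (real ?d / 2))"
      unfolding unit_ball_vol_def G S powr_diff using pos by simp
    fix r :: real
    show "?v r * ?g r = ennreal (if 0 < r then r ^ (?d - 1) * exp (- r\<^sup>2 / 2) /
        (2 powr (real ?d / 2 - 1) * Gamma (real ?d / 2)) else 0)"
    proof (cases "0 < r")
      case True
      have "?d * unit_ball_vol ?d * r ^ (?d - 1) * (exp (- r\<^sup>2 / 2) / sqrt (2 * pi) ^ ?d) =
          (?d * unit_ball_vol ?d / sqrt (2 * pi) ^ ?d) * (r ^ (?d - 1) * exp (- r\<^sup>2 / 2))"
        by simp
      also note c
      finally show ?thesis using True by (simp add: ennreal_mult'[symmetric])
    qed simp
  qed auto
  finally show ?thesis .
qed

text \<open>The density is a product of one-dimensional standard normal densities, each with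
  integral 1.\<close>

lemma prob_space_std_gaussian: "prob_space (std_gaussian :: (real ^ 'n) measure)"
proof
  have "emeasure (std_gaussian :: (real ^ 'n) measure) (space std_gaussian) =
     (\<integral>\<^sup>+x. ennreal (exp (- (norm (x :: real ^ 'n))\<^sup>2 / 2) / sqrt (2 * pi) ^ CARD('n)) \<partial>lborel)"
    by (simp add: std_gaussian_def emeasure_density)
  also have "\<dots> = (\<integral>\<^sup>+(x :: real ^ 'n). (\<Prod>b\<in>Basis. ennreal (std_normal_density (x \<bullet> b))) \<partial>lborel)"
  proof (intro nn_integral_cong)
    fix x :: "real ^ 'n"
    have "(\<Prod>b\<in>Basis. std_normal_density (x \<bullet> b)) =
        (1 / sqrt (2 * pi)) ^ CARD('n) * exp (\<Sum>b\<in>Basis. - (x \<bullet> b)\<^sup>2 / 2)"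
      by (simp add: std_normal_density_def prod.distrib exp_sum prod_dividef power_one_over)
    also have "(\<Sum>b\<in>Basis. - (x \<bullet> b)\<^sup>2 / 2) = - (norm x)\<^sup>2 / 2"
      unfolding power2_norm_eq_inner
      by (subst euclidean_inner) (simp add: power2_eq_square sum_negf sum_divide_distrib)
    finally show "ennreal (exp (- (norm x)\<^sup>2 / 2) / sqrt (2 * pi) ^ CARD('n)) =
        (\<Prod>b\<in>Basis. ennreal (std_normal_density (x \<bullet> b)))"
      by (simp add: prod_ennreal power_one_over)
  qed
  also have "\<dots> = (\<Prod>b\<in>(Basis :: (real ^ 'n) set). \<integral>\<^sup>+x. ennreal (std_normal_density x) \<partial>lborel)"
    by (rule nn_integral_lborel_prod) auto
  also have "(\<integral>\<^sup>+x. ennreal (std_normal_density x) \<partial>lborel) = 1"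
    using prob_space.emeasure_space_1[OF prob_space_normal_density[of 1 0]]
    by (simp add: emeasure_density)
  finally show "emeasure (std_gaussian :: (real ^ 'n) measure) (space std_gaussian) = 1" by simp
qed

lemma distr_std_gaussian_signed_perm:
  fixes p :: "'n::finite \<Rightarrow> 'n"
  assumes p: "bij p" and s: "\<And>k. \<bar>s k\<bar> = 1"
  shows "distr std_gaussian borel (signed_perm s p) = std_gaussian"
proof -
  let ?f = "signed_perm s p"
  let ?g = "\<lambda>x :: real ^ 'n. ennreal (exp (- (norm x)\<^sup>2 / 2) / sqrt (2 * pi) ^ CARD('n))"
  have "std_gaussian = density (distr lborel borel ?f) ?g"
    by (simp add: lborel_distr_signed_perm[OF p s] std_gaussian_def)
  also have "\<dots> = distr (density lborel (\<lambda>x. ?g (?f x))) borel ?f"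
    by (rule density_distr) auto
  also have "(\<lambda>x. ?g (?f x)) = ?g"
    by (simp add: norm_signed_perm[OF p s])
  finally show ?thesis by (simp add: std_gaussian_def)
qed

section \<open>Distribution function and quantiles of the chi distribution\<close>

lemma cdf_chi_strict_mono:
  assumes fin: "finite_measure (chi_distribution d)" and d: "0 < d" and r: "0 < r" and "s < r"
  shows "cdf (chi_distribution d) s < cdf (chi_distribution d) r"
proof (rule ccontr)
  interpret finite_measure "chi_distribution d" by (rule fin)
  define f where "f = (\<lambda>r::real. ennreal (if 0 < r then r ^ (d - 1) * exp (- r\<^sup>2 / 2) /
      (2 powr (real d / 2 - 1) * Gamma (real d / 2)) else 0))"
  have chi: "chi_distribution d = density lborel f"
    by (simp add: chi_distribution_def f_def)
  have meas: "f \<in> borel_measurable lborel" unfolding f_def by measurable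
  assume "\<not> cdf (chi_distribution d) s < cdf (chi_distribution d) r"
  moreover have "cdf (chi_distribution d) r = cdf (chi_distribution d) s + measure (chi_distribution d) {s<..r}"
  proof -
    have "{..r} = {..s} \<union> {s<..r}" using \<open>s < r\<close> by auto
    then show ?thesis unfolding cdf_def
      by (simp only:) (intro finite_measure_Union, auto simp: chi_distribution_def)
  qed
  ultimately have "measure (chi_distribution d) {s<..r} = 0"
    using zero_less_measure_iff by force
  then have "emeasure (chi_distribution d) {s<..r} = 0"
    by (simp add: emeasure_eq_measure)
  then have "emeasure (density lborel f) {s<..r} = 0"
    unfolding chi .
  then have ae: "AE x in lborel. x \<notin> {s<..r} \<or> f x = 0"
    using meas by (simp add: emeasure_density nn_integral_0_iff_AE indicator_def disj_commute)
  have pos: "f x > 0" if "0 < x" for x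
    using that d by (auto simp: f_def intro!: mult_pos_pos divide_pos_pos Gamma_real_pos)
  \<comment> \<open>Since \<open>s\<close> may be negative, the interval is cut down to the
    half-line where the density is positive; \<open>0 < r\<close> keeps its length positive.\<close>
  from ae have "AE x in lborel. x \<notin> {max 0 s<..r}"
  proof eventually_elim
    case (elim x)
    show ?case
    proof
      assume "x \<in> {max 0 s<..r}"
      then have "0 < x" "x \<in> {s<..r}" by auto
      with elim pos[of x] show False by simp
    qed
  qed
  then have "emeasure lborel {max 0 s<..r} = 0"
    by (subst (asm) AE_iff_measurable[where N = "{max 0 s<..r}"]) auto
  then show False using \<open>s < r\<close> r by auto
qed

text \<open>By strict monotonicity the set whose infimum is taken is exactly \<open>{r..}\<close>.
  At \<open>r \<le> 0\<close> the distribution function is 0 and the quantile would be minus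
  infinity.\<close>

lemma chi_quantile_cdf:
  assumes fin: "finite_measure (chi_distribution d)" and d: "0 < d" and r: "0 < r"
  shows "quantile (chi_distribution d) (cdf (chi_distribution d) r) = ereal r"
proof -
  interpret finite_measure "chi_distribution d" by (rule fin)
  note less = cdf_chi_strict_mono[OF fin d r]
  have "{s. cdf (chi_distribution d) r \<le> cdf (chi_distribution d) s} = {r..}"
  proof (intro set_eqI iffI; clarsimp)
    show "r \<le> s" if "cdf (chi_distribution d) r \<le> cdf (chi_distribution d) s" for s
      using less[of s] that by linarith
    show "cdf (chi_distribution d) r \<le> cdf (chi_distribution d) s" if "r \<le> s" for s
      unfolding cdf_def using that by (intro finite_measure_mono) (auto simp: chi_distribution_def)
  qed
  then show ?thesis unfolding quantile_def
    by (intro antisym Inf_lower Inf_greatest) auto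
qed

lemma AE_std_gaussian_nonzero: "AE x in std_gaussian. x \<noteq> (0 :: real ^ 'n)"
  unfolding std_gaussian_def by (subst AE_density) (use AE_lborel_singleton[of "0 :: real ^ 'n"] in auto)

lemma prob_space_chi_distribution: "prob_space (chi_distribution CARD('n::finite))"
proof -
  interpret prob_space "std_gaussian :: (real ^ 'n) measure" by (rule prob_space_std_gaussian)
  show ?thesis
    unfolding distr_std_gaussian_norm[where 'n = 'n, symmetric]
    by (rule prob_space_distr) (simp add: std_gaussian_def)
qed

text \<open>A strictly larger value, itself at most 1, is attained further right. Hence the quantile
  at 1 is infinite, and no bounded law has this distribution function.\<close>

lemma cdf_chi_less_1:
  assumes "prob_space (chi_distribution d)" "0 < d"
  shows "cdf (chi_distribution d) r < 1"
proof -
  interpret prob_space "chi_distribution d" by fact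
  have fin: "finite_measure (chi_distribution d)" by unfold_locales
  have "cdf (chi_distribution d) r < cdf (chi_distribution d) (max 0 r + 1)"
    by (rule cdf_chi_strict_mono[OF fin]) (use assms in auto)
  also have "\<dots> \<le> 1" unfolding cdf_def by (rule prob_le_1)
  finally show ?thesis .
qed

section \<open>Whitening with an isotropic covariance\<close>

lemma scaleR_mat_mult_vec: "(c *\<^sub>R mat 1 :: real ^ 'n ^ 'n) *v x = c *\<^sub>R x"
  by (simp add: scaleR_matrix_vector_assoc[symmetric])

text \<open>As \<open>matrix_sqrt\<close> is a definite description, the point is uniqueness of the
  positive definite root.\<close>

lemma matrix_sqrt_scaleR_mat:
  assumes c: "0 < c"
  shows "matrix_sqrt (c *\<^sub>R mat 1 :: real ^ 'n ^ 'n) = sqrt c *\<^sub>R mat 1"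
  unfolding matrix_sqrt_def
proof (rule the_equality)
  have "transpose (sqrt c *\<^sub>R mat 1 :: real ^ 'n ^ 'n) = sqrt c *\<^sub>R mat 1"
    by (simp add: transpose_def mat_def vec_eq_iff)
  moreover have "(sqrt c *\<^sub>R mat 1 :: real ^ 'n ^ 'n) ** (sqrt c *\<^sub>R mat 1) = c *\<^sub>R mat 1"
    using c by (simp add: matrix_eq matrix_vector_mul_assoc[symmetric] scaleR_mat_mult_vec)
  ultimately show "sym_pos_def (sqrt c *\<^sub>R mat 1 :: real ^ 'n ^ 'n) \<and>
      (sqrt c *\<^sub>R mat 1 :: real ^ 'n ^ 'n) ** (sqrt c *\<^sub>R mat 1) = c *\<^sub>R mat 1"
    using c by (simp add: sym_pos_def_def scaleR_mat_mult_vec)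
next
  fix S :: "real ^ 'n ^ 'n"
  assume S: "sym_pos_def S \<and> S ** S = c *\<^sub>R mat 1"
  have "S *v x = sqrt c *\<^sub>R x" for x
  proof (rule ccontr)
    assume ne: "S *v x \<noteq> sqrt c *\<^sub>R x"
    \<comment> \<open>\<open>(S + \<surd>c) (S - \<surd>c) = 0\<close>, and \<open>S + \<surd>c\<close> is positive definite.\<close>
    define y where "y = S *v x - sqrt c *\<^sub>R x"
    have "S *v (S *v x) = c *\<^sub>R x"
      using S by (simp add: matrix_vector_mul_assoc scaleR_mat_mult_vec)
    then have "S *v y + sqrt c *\<^sub>R y = 0"
      using c by (simp add: y_def matrix_vector_mult_diff_distrib matrix_vector_mult_scaleR scaleR_diff_right)
    then have "y \<bullet> (S *v y) + sqrt c * (y \<bullet> y) = 0"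
      by (metis inner_add_right inner_scaleR_right inner_zero_right)
    moreover have "0 < y \<bullet> (S *v y)" "0 < y \<bullet> y"
      using S ne by (auto simp: sym_pos_def_def y_def)
    ultimately show False
      using c by (smt (verit) mult_nonneg_nonneg real_sqrt_ge_zero)
  qed
  then show "S = sqrt c *\<^sub>R mat 1"
    by (simp add: matrix_eq scaleR_mat_mult_vec)
qed

lemma matrix_inv_scaleR_mat:
  assumes s: "s \<noteq> 0"
  shows "matrix_inv (s *\<^sub>R mat 1 :: real ^ 'n ^ 'n) = (1 / s) *\<^sub>R mat 1"
  unfolding matrix_inv_def
proof (rule some_equality)
  show "(s *\<^sub>R mat 1 :: real ^ 'n ^ 'n) ** ((1 / s) *\<^sub>R mat 1) = mat 1 \<and>
      ((1 / s) *\<^sub>R mat 1) ** (s *\<^sub>R mat 1 :: real ^ 'n ^ 'n) = mat 1"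
    using s by (simp add: matrix_eq matrix_vector_mul_assoc[symmetric] scaleR_mat_mult_vec)
next
  fix B :: "real ^ 'n ^ 'n"
  assume "(s *\<^sub>R mat 1) ** B = mat 1 \<and> B ** (s *\<^sub>R mat 1) = mat 1"
  then have "s *\<^sub>R (B *v x) = x" for x
    by (metis matrix_vector_mul_assoc matrix_vector_mul_lid scaleR_mat_mult_vec)
  then have "B *v x = (1 / s) *\<^sub>R x" for x
    using s by (metis inverse_eq_divide scaleR_scaleR left_inverse scaleR_one)
  then show "B = (1 / s) *\<^sub>R mat 1"
    by (simp add: matrix_eq scaleR_mat_mult_vec)
qed

lemma invertible_scaleR_mat:
  assumes "s \<noteq> 0"
  shows "invertible (s *\<^sub>R mat 1 :: real ^ 'n ^ 'n)"
  unfolding invertible_def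
proof (intro exI conjI)
  show "(s *\<^sub>R mat 1 :: real ^ 'n ^ 'n) ** ((1 / s) *\<^sub>R mat 1) = mat 1"
      "((1 / s) *\<^sub>R mat 1) ** (s *\<^sub>R mat 1 :: real ^ 'n ^ 'n) = mat 1"
    using assms by (simp_all add: matrix_eq matrix_vector_mul_assoc[symmetric] scaleR_mat_mult_vec)
qed

lemma T_VCReg_isotropic:
  assumes "mean_vector P = 0" "covariance_matrix P = c *\<^sub>R mat 1" "0 < c"
  shows "T_VCReg P x = (1 / sqrt c) *\<^sub>R x"
  using assms by (simp add: T_VCReg_def matrix_sqrt_scaleR_mat matrix_inv_scaleR_mat scaleR_mat_mult_vec)

lemma T_VCReg_measurable [measurable]: "T_VCReg P \<in> borel_measurable borel"
  unfolding T_VCReg_def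
  by (intro borel_measurable_continuous_onI continuous_intros matrix_vector_mult_linear_continuous_on[THEN continuous_on_compose2])
    auto

text \<open>The map \<open>x \<mapsto> - x\<close> kills the mean, the reflection of one coordinate
  kills the off-diagonal entries, and transpositions make the diagonal entries equal. Integrals that
  do not exist are 0 by convention, which agrees with these equations.\<close>

lemma
  fixes P :: "(real ^ 'n) measure"
  assumes sets: "sets P = sets borel"
    and inv: "\<And>s p. bij p \<Longrightarrow> (\<And>k. \<bar>s k\<bar> = 1) \<Longrightarrow> distr P borel (signed_perm s p) = P"
  shows signed_perm_invariant_mean: "mean_vector P = 0"
    and signed_perm_invariant_covariance: "covariance_matrix P = (\<integral>x. (x $ m)\<^sup>2 \<partial>P) *\<^sub>R mat 1"
proof -
  have int: "(\<integral>x. f x \<partial>P) = (\<integral>x. f (signed_perm s p x) \<partial>P)"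
    if "bij p" "\<And>k. \<bar>s k\<bar> = 1" "f \<in> borel_measurable borel"
    for s p and f :: "real ^ 'n \<Rightarrow> 'b::{banach, second_countable_topology}"
  proof -
    have "(\<integral>x. f x \<partial>P) = (\<integral>x. f x \<partial>distr P borel (signed_perm s p))"
      by (simp add: inv that)
    also have "\<dots> = (\<integral>x. f (signed_perm s p x) \<partial>P)"
      by (rule integral_distr) (use that sets in \<open>simp_all cong: measurable_cong_sets\<close>)
    finally show ?thesis .
  qed
  have minus: "signed_perm (\<lambda>_. -1) id x = - x" for x :: "real ^ 'n"
    by (simp add: signed_perm_def vec_eq_iff)
  have "(\<integral>x. x \<partial>P) = (\<integral>x. signed_perm (\<lambda>_. -1) id x \<partial>P)"
    by (rule int) auto
  also have "\<dots> = - (\<integral>x. x \<partial>P)"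
    unfolding minus by simp
  finally show mean: "mean_vector P = 0"
    by (simp add: mean_vector_def vec_eq_iff)
  have off: "(\<integral>x. x $ i * x $ j \<partial>P) = 0" if "i \<noteq> j" for i j
  proof -
    have "(\<integral>x. x $ i * x $ j \<partial>P) =
        (\<integral>x. signed_perm (\<lambda>k. if k = i then -1 else 1) id x $ i *
             signed_perm (\<lambda>k. if k = i then -1 else 1) id x $ j \<partial>P)"
      by (rule int) auto
    also have "\<dots> = - (\<integral>x. x $ i * x $ j \<partial>P)"
      using that by (simp add: signed_perm_def)
    finally show ?thesis by simp
  qed
  have diag: "(\<integral>x. x $ i * x $ i \<partial>P) = (\<integral>x. x $ m * x $ m \<partial>P)" for i
  proof -
    have "(\<integral>x. x $ i * x $ i \<partial>P) =
        (\<integral>x. signed_perm (\<lambda>_. 1) (Transposition.transpose i m) x $ i *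
             signed_perm (\<lambda>_. 1) (Transposition.transpose i m) x $ i \<partial>P)"
      by (rule int) auto
    then show ?thesis by (simp add: signed_perm_def)
  qed
  show "covariance_matrix P = (\<integral>x. (x $ m)\<^sup>2 \<partial>P) *\<^sub>R mat 1"
    using off diag by (simp add: covariance_matrix_def mean vec_eq_iff mat_def power2_eq_square)
qed

section \<open>The inclusion of the two families\<close>

lemma Fam_VCReg_subset: "(Fam_VCReg :: (real ^ 'n) measure set) \<subseteq> Fam_Radial_VCReg"
proof
  fix P :: "(real ^ 'n) measure"
  let ?chi = "chi_distribution CARD('n)"
  assume "P \<in> Fam_VCReg"
  then have adm: "admissible P" and T: "distr P borel (T_VCReg P) = std_gaussian"
    by (auto simp: Fam_VCReg_def)
  then have sets [measurable_cong]: "sets P = sets borel" by (simp add: admissible_def)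
  have "distr P borel (\<lambda>x. norm (T_VCReg P x)) = distr (distr P borel (T_VCReg P)) borel norm"
    by (subst distr_distr) (simp_all add: comp_def)
  then have F: "F_R P = cdf ?chi"
    by (simp add: F_R_def T distr_std_gaussian_norm)
  have fin: "finite_measure ?chi"
    using prob_space_chi_distribution by (rule prob_space.finite_measure)
  have val: "radial_value P x = ereal (norm (T_VCReg P x))" if "T_VCReg P x \<noteq> 0" for x
    unfolding radial_value_def F by (rule chi_quantile_cdf[OF fin]) (use that in auto)
  \<comment> \<open>Where \<open>T_VCReg P x = 0\<close>, the radial map scales the zero vector and
    also gives 0, so the maps agree everywhere and not just almost everywhere.\<close>
  have "T_Radial_VCReg P x = T_VCReg P x" for x
    using val[of x] by (cases "T_VCReg P x = 0") (simp_all add: T_Radial_VCReg_def)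
  then have "T_Radial_VCReg P = T_VCReg P" ..
  moreover have "AE x in P. radial_well_defined_at P x"
  proof -
    have "AE x in std_gaussian. x \<noteq> (0 :: real ^ 'n)"
      by (rule AE_std_gaussian_nonzero)
    then have "AE x in P. T_VCReg P x \<noteq> 0"
      unfolding T[symmetric] by (subst (asm) AE_distr_iff) auto
    then show ?thesis
      by eventually_elim (simp add: radial_well_defined_at_def val)
  qed
  ultimately show "P \<in> Fam_Radial_VCReg"
    using adm T by (simp add: Fam_Radial_VCReg_def)
qed

section \<open>A radially distorted Gaussian\<close>

definition shrink :: "'a::real_normed_vector \<Rightarrow> 'a" where
  "shrink x = (1 / (1 + norm x)) *\<^sub>R x"

lemma shrink_measurable [measurable]:
  "shrink \<in> borel_measurable (borel :: 'a::{real_normed_vector, second_countable_topology} measure)"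
  unfolding shrink_def by measurable

lemma norm_shrink: "norm (shrink x) = norm x / (1 + norm x)"
  by (simp add: shrink_def)

lemma norm_shrink_less_1: "norm (shrink x) < 1"
proof -
  have "0 < 1 + norm x" by (simp add: add_pos_nonneg)
  then show ?thesis by (simp add: norm_shrink)
qed

text \<open>The function \<open>r / (1 + r)\<close> is increasing for \<open>r \<ge> 0\<close>. This
  identifies balls before and after shrinking, and with them the two radial distribution
  functions.\<close>

lemma norm_shrink_le_iff: "norm (shrink x) \<le> norm (shrink y) \<longleftrightarrow> norm x \<le> norm y"
proof -
  have "0 < 1 + norm x" "0 < 1 + norm y" by (simp_all add: add_pos_nonneg)
  then show ?thesis by (simp add: norm_shrink divide_simps) (simp add: algebra_simps)
qed

text \<open>The inverse of \<open>shrink\<close> on the open unit ball. The value 0 outside is the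
  one that \<open>T_Radial_VCReg\<close> takes there, where the radial quantile is infinite, so the
  two functions can be equated at every point.\<close>

definition unshrink :: "'a::real_normed_vector \<Rightarrow> 'a" where
  "unshrink y = (if norm y < 1 then (1 / (1 - norm y)) *\<^sub>R y else 0)"

lemma unshrink_measurable [measurable]:
  "unshrink \<in> borel_measurable (borel :: 'a::{real_normed_vector, second_countable_topology} measure)"
  unfolding unshrink_def by measurable

lemma unshrink_shrink: "unshrink (shrink x) = x"
proof -
  have "0 < 1 + norm x" by (simp add: add_pos_nonneg)
  then have "1 - norm x / (1 + norm x) = 1 / (1 + norm x)" by (simp add: field_simps)
  then show ?thesis
    using norm_shrink_less_1[of x] \<open>0 < 1 + norm x\<close> by (simp add: unshrink_def norm_shrink) (simp add: shrink_def)
qed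

lemma shrink_unshrink:
  assumes "norm y < 1"
  shows "shrink (unshrink y) = y"
proof -
  have "1 + norm y / (1 - norm y) = 1 / (1 - norm y)" using assms by (simp add: field_simps)
  then show ?thesis
    using assms by (simp add: unshrink_def shrink_def)
qed

definition shrunk_gaussian :: "(real ^ 'n) measure" where
  "shrunk_gaussian = distr std_gaussian borel shrink"

lemma sets_shrunk_gaussian [simp, measurable_cong]: "sets shrunk_gaussian = sets borel"
  by (simp add: shrunk_gaussian_def)

lemma shrink_signed_perm:
  assumes p: "bij p" and s: "\<And>k. \<bar>s k\<bar> = 1"
  shows "shrink (signed_perm s p x) = signed_perm s p (shrink x)"
  by (simp add: shrink_def norm_signed_perm[OF assms]) (simp add: signed_perm_def vec_eq_iff)

lemma shrunk_gaussian_signed_perm: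
  assumes p: "bij p" and s: "\<And>k. \<bar>s k\<bar> = 1"
  shows "distr shrunk_gaussian borel (signed_perm s p) = shrunk_gaussian"
proof -
  have "distr shrunk_gaussian borel (signed_perm s p) = distr std_gaussian borel (\<lambda>x. shrink (signed_perm s p x))"
    unfolding shrunk_gaussian_def by (subst distr_distr) (simp_all add: comp_def shrink_signed_perm[OF assms])
  also have "\<dots> = distr (distr std_gaussian borel (signed_perm s p)) borel shrink"
    by (subst distr_distr) (simp_all add: comp_def)
  finally show ?thesis
    by (simp add: distr_std_gaussian_signed_perm[OF assms] shrunk_gaussian_def)
qed

lemma prob_space_shrunk_gaussian: "prob_space (shrunk_gaussian :: (real ^ 'n) measure)"
  unfolding shrunk_gaussian_def
  by (intro prob_space.prob_space_distr prob_space_std_gaussian) simp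

lemma AE_shrunk_gaussian: "AE x in shrunk_gaussian :: (real ^ 'n) measure. norm x < 1 \<and> x \<noteq> 0"
proof -
  have "AE x in std_gaussian :: (real ^ 'n) measure. norm (shrink x) < 1 \<and> shrink x \<noteq> 0"
    using AE_std_gaussian_nonzero
  proof eventually_elim
    case (elim x)
    then show ?case using norm_shrink_less_1[of x] add_nonneg_pos[of "norm x" 1] by (simp add: shrink_def add.commute)
  qed
  then show ?thesis
    unfolding shrunk_gaussian_def by (subst AE_distr_iff) auto
qed

lemma shrunk_gaussian_isotropic:
  obtains c where "0 < c" "mean_vector (shrunk_gaussian :: (real ^ 'n) measure) = 0"
    "covariance_matrix (shrunk_gaussian :: (real ^ 'n) measure) = c *\<^sub>R mat 1"
proof -
  let ?P = "shrunk_gaussian :: (real ^ 'n) measure"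
  interpret prob_space ?P by (rule prob_space_shrunk_gaussian)
  define c where "c m = (\<integral>x. (x $ m)\<^sup>2 \<partial>?P)" for m
  have cov: "covariance_matrix ?P = c m *\<^sub>R mat 1" for m
    unfolding c_def by (rule signed_perm_invariant_covariance) (simp_all add: shrunk_gaussian_signed_perm)
  \<comment> \<open>The covariance formula holds with any coordinate as reference, so the variances
    are read off from one and the same matrix.\<close>
  have c_eq: "c k = c m" for k m
  proof -
    have "(c k *\<^sub>R mat 1 :: real ^ 'n ^ 'n) $ k $ k = (c m *\<^sub>R mat 1 :: real ^ 'n ^ 'n) $ k $ k"
      by (simp only: cov[symmetric])
    then show ?thesis by (simp add: mat_def)
  qed
  have int: "integrable ?P (\<lambda>x. (x $ m)\<^sup>2)" for m
  proof (rule integrable_const_bound[where B = 1])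
    show "AE x in ?P. norm ((x $ m)\<^sup>2) \<le> 1"
      using AE_shrunk_gaussian
    proof eventually_elim
      case (elim x)
      then have "\<bar>x $ m\<bar> \<le> 1" using component_le_norm_cart[of x m] by simp
      then show ?case by (simp add: abs_square_le_1)
    qed
  qed simp
  \<comment> \<open>If one variance vanished, all would, and the law would sit at the origin, which
    has probability 0.\<close>
  have "c m \<noteq> 0" for m
  proof
    assume "c m = 0"
    then have "c k = 0" for k using c_eq[of k m] by simp
    then have "AE x in ?P. (x $ k)\<^sup>2 = 0" for k
      using integral_nonneg_eq_0_iff_AE[OF int[of k]] by (simp add: c_def)
    then have "AE x in ?P. \<forall>k. (x $ k)\<^sup>2 = 0"
      by (intro AE_all_countable[THEN iffD2]) auto
    then have "AE x in ?P. False"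
      using AE_shrunk_gaussian by eventually_elim (auto simp: vec_eq_iff)
    then show False by simp
  qed
  moreover have "0 \<le> c m" for m unfolding c_def by (rule integral_nonneg_AE) simp
  ultimately have "0 < c m" for m by (metis less_le)
  moreover have "mean_vector ?P = 0"
    by (rule signed_perm_invariant_mean) (simp_all add: shrunk_gaussian_signed_perm)
  ultimately show ?thesis using that cov by blast
qed

lemma admissible_shrunk_gaussian: "admissible (shrunk_gaussian :: (real ^ 'n) measure)"
proof -
  let ?P = "shrunk_gaussian :: (real ^ 'n) measure"
  interpret prob_space ?P by (rule prob_space_shrunk_gaussian)
  have "integrable ?P (\<lambda>x. (norm x)\<^sup>2)"
  proof (rule integrable_const_bound[where B = 1])
    show "AE x in ?P. norm ((norm x)\<^sup>2) \<le> 1"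
      using AE_shrunk_gaussian by eventually_elim (simp add: abs_square_le_1)
  qed simp
  moreover have "invertible (covariance_matrix ?P)"
  proof -
    obtain c where "0 < c" "covariance_matrix ?P = c *\<^sub>R mat 1"
      using shrunk_gaussian_isotropic by metis
    then show ?thesis using invertible_scaleR_mat[of c] by simp
  qed
  ultimately show ?thesis
    by (simp add: admissible_def prob_space_shrunk_gaussian)
qed

lemma
  shows shrunk_gaussian_in_Fam_Radial: "(shrunk_gaussian :: (real ^ 'n) measure) \<in> Fam_Radial_VCReg"
    and shrunk_gaussian_notin_Fam_VCReg: "(shrunk_gaussian :: (real ^ 'n) measure) \<notin> Fam_VCReg"
proof -
  let ?P = "shrunk_gaussian :: (real ^ 'n) measure"
  let ?G = "std_gaussian :: (real ^ 'n) measure"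
  let ?chi = "chi_distribution CARD('n)"
  interpret G: prob_space ?G by (rule prob_space_std_gaussian)
  have chi: "prob_space ?chi" by (rule prob_space_chi_distribution)
  then have fin: "finite_measure ?chi" by (rule prob_space.finite_measure)
  note less1 = cdf_chi_less_1[OF chi]
  obtain c where c: "0 < c" and "mean_vector ?P = 0" "covariance_matrix ?P = c *\<^sub>R mat 1"
    using shrunk_gaussian_isotropic by metis
  then have T: "T_VCReg ?P x = (1 / sqrt c) *\<^sub>R x" for x
    by (intro T_VCReg_isotropic)
  have nT: "norm (T_VCReg ?P x) = norm x / sqrt c" for x
    using c by (simp add: T)
  \<comment> \<open>The whitening factor \<open>1 / sqrt c\<close> appears on both sides of the
    inequality between norms and cancels, so the value of \<open>c\<close> never has to be
    computed.\<close>
  have F: "F_R ?P (norm y / sqrt c) = measure ?G {x. norm (shrink x) \<le> norm y}" for y :: "real ^ 'n"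
  proof -
    have "distr ?P borel (\<lambda>x. norm (T_VCReg ?P x)) = distr ?G borel (\<lambda>x. norm (shrink x) / sqrt c)"
      unfolding nT unfolding shrunk_gaussian_def by (subst distr_distr) (simp_all add: comp_def)
    then show ?thesis
      using c unfolding F_R_def cdf_def
      by (simp add: measure_distr vimage_def divide_le_cancel)
  qed
  \<comment> \<open>The law lives in the open unit ball, so the radial distribution function reaches
    1 at a finite radius.\<close>
  have F1: "F_R ?P (norm y / sqrt c) = 1" if "1 \<le> norm y" for y :: "real ^ 'n"
  proof -
    have "{x :: real ^ 'n. norm (shrink x) \<le> norm y} = space ?G"
      using that norm_shrink_less_1 by (auto intro: less_imp_le less_le_trans)
    then show ?thesis by (simp only: F G.prob_space)
  qed
  have F2: "F_R ?P (norm (shrink x) / sqrt c) = cdf ?chi (norm x)" for x :: "real ^ 'n"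
    by (simp add: F norm_shrink_le_iff distr_std_gaussian_norm[symmetric] cdf_def measure_distr vimage_def)
  have val: "radial_value ?P y = (if norm y < 1 then ereal (norm (unshrink y)) else \<infinity>)" if "y \<noteq> 0" for y
  proof (cases "norm y < 1")
    case True
    then have "radial_value ?P y = quantile ?chi (cdf ?chi (norm (unshrink y)))"
      using F2[of "unshrink y"] by (simp add: radial_value_def nT shrink_unshrink)
    also have "\<dots> = ereal (norm (unshrink y))"
      using that True by (intro chi_quantile_cdf[OF fin]) (auto simp: unshrink_def)
    finally show ?thesis using True by simp
  next
    case False
    then have "radial_value ?P y = quantile ?chi 1"
      by (simp add: radial_value_def nT F1)
    \<comment> \<open>No real argument brings the chi distribution function up to 1, so this is the
      infimum of the empty set.\<close>
    also have "\<dots> = \<infinity>"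
      using less1 by (simp add: quantile_def not_le[symmetric] top_ereal_def)
    finally show ?thesis using False by simp
  qed
  have "T_Radial_VCReg ?P y = unshrink y" for y
  proof (cases "y = 0")
    case True
    then show ?thesis by (simp add: T_Radial_VCReg_def T unshrink_def)
  next
    case False
    then show ?thesis
      using c by (simp add: T_Radial_VCReg_def nT T val) (simp add: unshrink_def)
  qed
  then have TR: "T_Radial_VCReg ?P = unshrink" ..
  have "distr ?P borel (T_Radial_VCReg ?P) = distr ?G borel (\<lambda>x. x)"
    unfolding TR unfolding shrunk_gaussian_def by (subst distr_distr) (simp_all add: comp_def unshrink_shrink)
  also have "\<dots> = ?G" by (rule distr_id2) simp
  finally have "distr ?P borel (T_Radial_VCReg ?P) = ?G" .
  moreover have "AE x in ?P. radial_well_defined_at ?P x"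
    using AE_shrunk_gaussian by eventually_elim (use c in \<open>simp add: radial_well_defined_at_def val T\<close>)
  ultimately show "?P \<in> Fam_Radial_VCReg"
    by (simp add: Fam_Radial_VCReg_def admissible_shrunk_gaussian)
  show "?P \<notin> Fam_VCReg"
  proof
    assume "?P \<in> Fam_VCReg"
    then have "?chi = distr (distr ?P borel (T_VCReg ?P)) borel norm"
      by (simp add: Fam_VCReg_def distr_std_gaussian_norm)
    also have "\<dots> = distr ?P borel (\<lambda>x. norm (T_VCReg ?P x))"
      by (subst distr_distr) (simp_all add: comp_def)
    finally have "F_R ?P = cdf ?chi" by (simp add: F_R_def)
    \<comment> \<open>Any unit vector would do: at radius \<open>1 / sqrt c\<close> the value 1 is
      attained, which the chi distribution function never does.\<close>
    moreover have "F_R ?P (norm (axis undefined 1 :: real ^ 'n) / sqrt c) = 1"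
      by (rule F1) simp
    ultimately show False using less1[of "1 / sqrt c"] by simp
  qed
qed

theorem proposition1:
  "(Fam_VCReg :: (real ^ 'n) measure set) \<subset> Fam_Radial_VCReg"
  using Fam_VCReg_subset shrunk_gaussian_in_Fam_Radial shrunk_gaussian_notin_Fam_VCReg by blast

end
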